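(* Let $(\Omega,\mathcal A,P)$ be a probability space, let $\{A_n, n\ge 1\}$ be a sequence of events in $\mathcal A$, and let $\mathcal F\subseteq\mathcal A$ be a sub-$\sigma$-algebra such that $P(A_n\mid\mathcal F)\to 0$ almost surely as $n\to\infty$. Suppose that for some integer $m\ge 0$, $$\sum_{n=1}^\infty P\big(A_n^c A_{n+1}^c\cdots A_{n+m-1}^c A_{n+m}\mid\mathcal F\big)<\infty\quad\text{almost surely.}$$ Then $P(\limsup A_n\mid\mathcal F)=0$ almost surely, and hence $P(\limsup A_n)=0$.
   Context: $\limsup A_n=\bigcap_{n=1}^\infty\bigcup_{i=n}^\infty A_i$ is the event that $A_n$ occurs infinitely often. $A^c$ is the complement of $A$, and juxtaposition of events denotes intersection, so $A_n^c\cdots A_{n+m-1}^cA_{n+m}=\big(\bigcap_{j=0}^{m-1}A_{n+j}^c\big)\cap A_{n+m}$ (for $m=0$ this is just $A_n$). $P(A\mid\mathcal F)=E[\mathbf 1_A\mid\mathcal F]$. *)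

theory Defs
  imports "HOL-Probability.Probability"
begin

text \<open>The conditional probability \<open>P(A | F) = E[1_A | F]\<close>. The sub-sigma-algebra is given, as in
  \<^theory>\<open>HOL-Probability.Conditional_Expectation\<close>, by a measure \<open>F\<close> with \<open>subalgebra M F\<close>; only
  \<open>space F\<close> and \<open>sets F\<close> matter. The library fixes one version of the conditional expectation,
  so statements about it are meaningful up to almost sure equality.\<close>

definition cond_prob_given :: "'a measure \<Rightarrow> 'a measure \<Rightarrow> 'a set \<Rightarrow> 'a \<Rightarrow> real" where
  "cond_prob_given M F A = real_cond_exp M F (indicator A)"

text \<open>The event that none of \<open>A n, \<dots>, A (n + m - 1)\<close> occurs but \<open>A (n + m)\<close> does. For \<open>m = 0\<close> the
  empty intersection is \<open>UNIV\<close>, so the event is \<open>A n\<close>.\<close>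

definition delayed_event :: "'a measure \<Rightarrow> (nat \<Rightarrow> 'a set) \<Rightarrow> nat \<Rightarrow> nat \<Rightarrow> 'a set" where
  "delayed_event M A m n = (\<Inter>j<m. space M - A (n + j)) \<inter> A (n + m)"

text \<open>For sequences of sets, the lattice-theoretic \<open>limsup\<close> is the event ``infinitely often'';
  it does not depend on \<open>A 0\<close>, so it serves for sequences indexed from 1.\<close>

lemma limsup_sets_from_1:
  fixes A :: "nat \<Rightarrow> 'a set"
  shows "limsup A = (\<Inter>n\<in>{1..}. \<Union>i\<in>{n..}. A i)"
proof -
  have "limsup A = (\<Inter>n. \<Union>i\<in>{n..}. A i)"
    by (simp add: limsup_INF_SUP)
  also have "\<dots> = (\<Inter>n\<in>{1..}. \<Union>i\<in>{n..}. A i)"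
  proof (intro equalityI subsetI INT_I)
    fix x n assume x: "x \<in> (\<Inter>n\<in>{1..}. \<Union>i\<in>{n..}. A i)"
    then have "x \<in> (\<Union>i\<in>{Suc n..}. A i)"
      by (rule INT_D) simp
    then obtain i where "i \<ge> Suc n" "x \<in> A i"
      by blast
    then show "x \<in> (\<Union>i\<in>{n..}. A i)"
      by (intro UN_I[of i]) auto
  qed auto
  finally show ?thesis .
qed

lemma limsup_sets_from_1_measurable:
  assumes "\<And>n. n \<ge> 1 \<Longrightarrow> A n \<in> sets M"
  shows "limsup A \<in> sets M"
  unfolding limsup_sets_from_1
  using assms by (intro sets.countable_INT'' sets.countable_INT' sets.countable_UN') auto

end

theory Submission
  imports Defs
begin

text \<open>Taking expectations in the first hypothesis gives \<open>P(A n) \<longlonglongrightarrow> 0\<close> by dominated convergence,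
  so for fixed \<open>m\<close> almost surely some arbitrarily late window \<open>A n \<union> \<dots> \<union> A (n + m - 1)\<close> fails to
  occur. By a conditional Borel--Cantelli lemma, almost surely only finitely many delayed events
  occur. After the last one, a window without an occurrence can only be followed by windows
  without an occurrence, so the \<open>A n\<close> stop occurring altogether.\<close>

lemma delayed_event_sets:
  assumes "\<And>n. n \<ge> 1 \<Longrightarrow> A n \<in> sets M" and "n \<ge> 1"
  shows "delayed_event M A m n \<in> sets M"
proof -
  \<comment> \<open>For \<open>m = 0\<close> the intersection is \<open>UNIV\<close>, which need not
    be measurable; as a difference of measurable sets the event is covered for every
    \<open>m\<close>.\<close>
  have "(\<Inter>j<m. space M - A (n + j)) \<inter> A (n + m) = A (n + m) - (\<Union>j<m. A (n + j)) \<inter> space M"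
    using sets.sets_into_space[OF assms(1)[of "n + m"]] assms(2) by auto
  also have "\<dots> \<in> sets M"
    using assms by (intro sets.Diff sets.Int sets.top sets.finite_UN) auto
  finally show ?thesis
    by (simp add: delayed_event_def)
qed

context finite_measure_subalgebra
begin

lemma integrable_indicator_sets [simp]:
  "E \<in> sets M \<Longrightarrow> integrable M (indicator E :: 'a \<Rightarrow> real)"
  by (simp add: less_top[symmetric])

lemma cond_prob_given_integral:
  assumes "E \<in> sets M"
  shows "(\<integral>x. cond_prob_given M F E x \<partial>M) = measure M E"
  using assms by (simp add: cond_prob_given_def real_cond_exp_int)

lemma cond_prob_given_bounds:
  assumes "E \<in> sets M"
  shows "AE x in M. 0 \<le> cond_prob_given M F E x \<and> cond_prob_given M F E x \<le> 1"
  using real_cond_exp_ge_c[of "indicator E" 0] real_cond_exp_le_c[of "indicator E" 1] assms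
  by (auto simp: cond_prob_given_def indicator_def)

lemma cond_prob_given_null:
  assumes "E \<in> null_sets M"
  shows "AE x in M. cond_prob_given M F E x = 0"
proof -
  have "AE x in M. real_cond_exp M F (indicator E) x = real_cond_exp M F (\<lambda>_. 0) x"
    using AE_not_in[OF assms] assms
    by (intro real_cond_exp_cong) (auto simp: null_setsD2 elim!: AE_mp)
  moreover have "AE x in M. real_cond_exp M F (\<lambda>_. 0) x = 0"
    by (rule real_cond_exp_F_meas) auto
  ultimately show ?thesis
    unfolding cond_prob_given_def by eventually_elim simp
qed

lemma measure_tendsto_0_if_cond_prob_given:
  assumes E: "\<And>n. E n \<in> sets M"
    and lim: "AE x in M. (\<lambda>n. cond_prob_given M F (E n) x) \<longlonglongrightarrow> 0"
  shows "(\<lambda>n. measure M (E n)) \<longlonglongrightarrow> 0"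
proof -
  have "(\<lambda>n. \<integral>x. cond_prob_given M F (E n) x \<partial>M) \<longlonglongrightarrow> (\<integral>x. 0 \<partial>M)"
  proof (rule integral_dominated_convergence[where w = "\<lambda>_. 1"])
    show "AE x in M. norm (cond_prob_given M F (E n) x) \<le> 1" for n
      using cond_prob_given_bounds[OF E[of n]] by auto
  qed (use lim in \<open>auto simp: cond_prob_given_def\<close>)
  then show ?thesis
    by (simp add: cond_prob_given_integral[OF E])
qed

text \<open>The sum of the conditional probabilities is finite almost surely but need not be
  integrable, so the probabilities of the \<open>E n\<close> themselves may fail to be
  summable.\<close>

lemma cond_borel_cantelli:
  assumes E [measurable]: "\<And>n. E n \<in> sets M"
    and sum: "AE x in M. summable (\<lambda>n. cond_prob_given M F (E n) x)"
  shows "AE x in M. eventually (\<lambda>n. x \<notin> E n) sequentially"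
proof -
  let ?p = "\<lambda>n. cond_prob_given M F (E n)"
  \<comment> \<open>Localizing to these \<open>F\<close>-measurable sets reduces the claim to the ordinary lemma.\<close>
  define B where "B k = {x \<in> space F. \<forall>N. (\<Sum>n<N. ?p n x) \<le> real k}" for k :: nat
  have p_F [measurable]: "?p n \<in> borel_measurable F" for n
    by (simp add: cond_prob_given_def)
  have p_int: "integrable M (?p n)" for n
    by (simp add: cond_prob_given_def real_cond_exp_int)
  \<comment> \<open>Bounding all partial sums, rather than \<open>suminf\<close>, avoids its
    unspecified value where the series diverges.\<close>
  have B_F: "B k \<in> sets F" for k
    unfolding B_def by measurable
  then have B_M [measurable]: "B k \<in> sets M" for k
    using subalg by (auto simp: subalgebra_def)
  \<comment> \<open>Since \<open>B k\<close> is in \<open>F\<close>, its indicator can be moved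
    inside the conditional expectation before integrating.\<close>
  have meas: "measure M (E n \<inter> B k) = (\<integral>x. indicator (B k) x * ?p n x \<partial>M)" for n k
  proof -
    have eq: "indicator (B k) x * indicator (E n) x = (indicator (E n \<inter> B k) x :: real)" for x
      by (auto simp: indicator_def)
    have "(\<integral>x. indicator (B k) x * ?p n x \<partial>M) = (\<integral>x. indicator (B k) x * indicator (E n) x \<partial>M)"
      unfolding cond_prob_given_def using B_F by (intro real_cond_exp_intg) (auto simp: eq)
    then show ?thesis
      by (simp add: eq)
  qed
  have fin: "AE x in M. x \<in> B k \<longrightarrow> eventually (\<lambda>n. x \<notin> E n) sequentially" for k
  proof -
    have int: "integrable M (\<lambda>x. indicator (B k) x * ?p n x)" for n
      using integrable_mult_indicator[OF B_M p_int] by simp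
    have "summable (\<lambda>n. measure M (E n \<inter> B k))"
    proof (rule summableI_nonneg_bounded)
      fix N
      have "(\<Sum>n<N. measure M (E n \<inter> B k)) = (\<integral>x. (\<Sum>n<N. indicator (B k) x * ?p n x) \<partial>M)"
        unfolding meas using int by (subst Bochner_Integration.integral_sum) auto
      also have "\<dots> \<le> (\<integral>x. real k \<partial>M)"
      proof (rule integral_mono)
        show "integrable M (\<lambda>x. \<Sum>n<N. indicator (B k) x * ?p n x)"
          by (intro Bochner_Integration.integrable_sum int)
        show "(\<Sum>n<N. indicator (B k) x * ?p n x) \<le> real k" for x
          by (cases "x \<in> B k") (auto simp: B_def)
      qed simp
      finally show "(\<Sum>n<N. measure M (E n \<inter> B k)) \<le> (\<integral>x. real k \<partial>M)" .
    qed simp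
    then have "AE x in M. eventually (\<lambda>n. x \<in> space M - (E n \<inter> B k)) sequentially"
      by (intro borel_cantelli_AE1) (auto simp: less_top[symmetric])
    then show ?thesis
      by eventually_elim (auto simp: eventually_conj_iff frequently_def)
  qed
  have nonneg: "AE x in M. \<forall>n. 0 \<le> ?p n x"
    unfolding AE_all_countable using cond_prob_given_bounds[OF E] by (auto elim: AE_mp)
  have "AE x in M. \<forall>k. x \<in> B k \<longrightarrow> eventually (\<lambda>n. x \<notin> E n) sequentially"
    unfolding AE_all_countable using fin by blast
  \<comment> \<open>The sets \<open>B k\<close> cover almost every point: where the terms are
    nonnegative and summable, any \<open>k\<close> above the total bounds all partial sums.\<close>
  with sum nonneg AE_space show ?thesis
  proof eventually_elim
    case (elim x)
    obtain k :: nat where k: "(\<Sum>n. ?p n x) \<le> real k"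
      using real_arch_simple by blast
    have "(\<Sum>n<N. ?p n x) \<le> real k" for N
      using sum_le_suminf[of "\<lambda>n. ?p n x" "{..<N}"] elim k by fastforce
    then have "x \<in> B k"
      using elim subalg by (auto simp: B_def subalgebra_def)
    then show ?case
      using elim by blast
  qed
qed

end

text \<open>An intersection of all windows from \<open>N\<close> on lies in each single one of them,
  whose measure is at most a sum of \<open>m\<close> terms tending to 0. So it is null, and there
  are only countably many \<open>N\<close>.\<close>

lemma (in finite_measure) windows_not_eventually:
  assumes A: "\<And>n. A n \<in> sets M" and lim: "(\<lambda>n. measure M (A n)) \<longlonglongrightarrow> 0"
  shows "AE x in M. \<not> eventually (\<lambda>n. x \<in> (\<Union>j<m. A (n + j))) sequentially"
proof -
  let ?W = "\<lambda>n. \<Union>j<m. A (n + j)"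
  have W: "?W n \<in> sets M" for n
    using A by auto
  have W_lim: "(\<lambda>n. \<Sum>j<m. measure M (A (n + j))) \<longlonglongrightarrow> 0"
    by (intro tendsto_null_sum LIMSEQ_ignore_initial_segment lim)
  have "(\<Inter>n\<in>{N..}. ?W n) \<in> null_sets M" for N
  proof -
    have I: "(\<Inter>n\<in>{N..}. ?W n) \<in> sets M"
      using W by (intro sets.countable_INT') auto
    have "measure M (\<Inter>n\<in>{N..}. ?W n) \<le> (\<Sum>j<m. measure M (A (n + j)))" if "n \<ge> N" for n
    proof -
      have "measure M (\<Inter>n\<in>{N..}. ?W n) \<le> measure M (?W n)"
        using that W by (intro finite_measure_mono) auto
      also have "\<dots> \<le> (\<Sum>j<m. measure M (A (n + j)))"
        using A by (intro measure_UNION_le) auto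
      finally show ?thesis .
    qed
    then have "measure M (\<Inter>n\<in>{N..}. ?W n) \<le> 0"
      by (intro LIMSEQ_le_const[OF W_lim]) blast
    then show ?thesis
      using I by (simp add: null_sets_def emeasure_eq_measure measure_le_0_iff)
  qed
  then have "AE x in M. \<forall>N. x \<notin> (\<Inter>n\<in>{N..}. ?W n)"
    unfolding AE_all_countable using AE_not_in by blast
  then show ?thesis
    by eventually_elim (auto simp: eventually_sequentially)
qed

text \<open>This is pointwise and involves no probability: were a late window missed, the first
  later occurrence would complete a delayed event, so there would be none, against
  \<open>x \<in> limsup A\<close>.\<close>

lemma eventually_windows_if_no_delayed_event:
  assumes "x \<in> space M" "x \<in> limsup A"
    and "eventually (\<lambda>n. x \<notin> delayed_event M A m n) sequentially"
  shows "eventually (\<lambda>n. x \<in> (\<Union>j<m. A (n + j))) sequentially"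
proof -
  obtain N where N: "\<And>n. n \<ge> N \<Longrightarrow> x \<notin> delayed_event M A m n"
    using assms(3) by (auto simp: eventually_sequentially)
  have "x \<in> (\<Union>j<m. A (n + j))" if "n \<ge> N" for n
  proof (rule ccontr)
    assume start: "x \<notin> (\<Union>j<m. A (n + j))"
    have "x \<notin> A (n + i)" for i
    proof (induction i rule: less_induct)
      case (less i)
      show ?case
      proof (cases "i < m")
        case True
        with start show ?thesis by auto
      next
        case False
        \<comment> \<open>The delayed event that would end at \<open>n + i\<close> starts at
          \<open>n + (i - m)\<close>; the induction hypothesis supplies its \<open>m\<close>
          non-occurrences.\<close>
        then have i: "n + i = (n + (i - m)) + m" "\<And>j. j < m \<Longrightarrow> i - m + j < i"
          by auto
        have "x \<notin> A (n + (i - m) + j)" if "j < m" for j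
          using less i(2)[OF that] by (simp add: add.assoc)
        moreover have "x \<notin> delayed_event M A m (n + (i - m))"
          using N \<open>n \<ge> N\<close> by simp
        ultimately show ?thesis
          unfolding i(1) using assms(1) by (auto simp: delayed_event_def)
      qed
    qed
    moreover obtain k where "k \<ge> n" "x \<in> A k"
      using assms(2) by (auto simp: limsup_INF_SUP)
    ultimately show False
      by (metis le_Suc_ex)
  qed
  then show ?thesis
    by (auto simp: eventually_sequentially)
qed

theorem theorem1p5:
  fixes M F :: "'a measure" and A :: "nat \<Rightarrow> 'a set" and m :: nat
  assumes "prob_space M"
    and "subalgebra M F"
    and "\<And>n. n \<ge> 1 \<Longrightarrow> A n \<in> sets M"
    and "AE x in M. (\<lambda>n. cond_prob_given M F (A n) x) \<longlonglongrightarrow> 0"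
    and "AE x in M. summable (\<lambda>n. cond_prob_given M F (delayed_event M A m (Suc n)) x)"
  shows "(AE x in M. cond_prob_given M F (limsup A) x = 0) \<and> measure M (limsup A) = 0"
proof -
  interpret prob_space M by fact
  interpret finite_measure_subalgebra M F
    by unfold_locales fact
  \<comment> \<open>The sequence is shifted by one here and below because nothing is assumed about
    \<open>A 0\<close>, which may even be non-measurable.\<close>
  have D: "AE x in M. eventually (\<lambda>n. x \<notin> delayed_event M A m (Suc n)) sequentially"
    using assms(5) by (intro cond_borel_cantelli delayed_event_sets assms(3)) auto
  have "AE x in M. (\<lambda>n. cond_prob_given M F (A (Suc n)) x) \<longlonglongrightarrow> 0"
    using assms(4) by eventually_elim (rule LIMSEQ_Suc)
  then have "(\<lambda>n. measure M (A (Suc n))) \<longlonglongrightarrow> 0"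
    by (intro measure_tendsto_0_if_cond_prob_given assms(3)) auto
  then have W: "AE x in M. \<not> eventually (\<lambda>n. x \<in> (\<Union>j<m. A (Suc (n + j)))) sequentially"
    by (intro windows_not_eventually[where A = "\<lambda>n. A (Suc n)"] assms(3)) auto
  have "AE x in M. x \<notin> limsup A"
    using D W AE_space
  proof eventually_elim
    case (elim x)
    show ?case
    proof
      assume "x \<in> limsup A"
      moreover have "eventually (\<lambda>n. x \<notin> delayed_event M A m n) sequentially"
        using elim(1) eventually_sequentially_Suc[of "\<lambda>n. x \<notin> delayed_event M A m n"] by simp
      ultimately have "eventually (\<lambda>n. x \<in> (\<Union>j<m. A (n + j))) sequentially"
        using elim(3) by (intro eventually_windows_if_no_delayed_event)
      then have "eventually (\<lambda>n. x \<in> (\<Union>j<m. A (Suc n + j))) sequentially"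
        by (subst eventually_sequentially_Suc)
      with elim(2) show False
        by simp
    qed
  qed
  then have null: "limsup A \<in> null_sets M"
    using limsup_sets_from_1_measurable[of A M] assms(3) by (simp add: AE_iff_null_sets)
  \<comment> \<open>The unconditional claim is obtained first; the conditional one follows because
    null sets have conditional probability 0 almost surely.\<close>
  then show ?thesis
    using cond_prob_given_null by (auto simp: null_sets_def measure_def)
qed

end
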